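(* For all positive integers $n$ and $m$ with $m\ge 2$, $$\hat{r}(2K_2,nP_m)=\min\{nm+1,\,(n+1)(m-1)\}.$$
   Context: All graphs are finite and simple. For graphs $G_1,G_2$, the size Ramsey number $\hat{r}(G_1,G_2)$ is the smallest positive integer $m$ such that there exists a graph $G$ with $m$ edges with the property that for every coloring of the edges of $G$ with red and blue, $G$ contains a red subgraph isomorphic to $G_1$ or a blue subgraph isomorphic to $G_2$. $2K_2$ denotes the matching with two edges. $P_m$ is the path with $m$ vertices, and $nP_m$ is the disjoint union of $n$ copies of $P_m$. *)

theory Defs
  imports Main
begin

type_synonym 'a graph = "'a set \<times> 'a set set"

abbreviation verts :: "'a graph \<Rightarrow> 'a set" where "verts \<equiv> fst"
abbreviation edges :: "'a graph \<Rightarrow> 'a set set" where "edges \<equiv> snd"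

definition simple_graph :: "'a graph \<Rightarrow> bool" where
  "simple_graph G \<longleftrightarrow> finite (verts G) \<and> (\<forall>e\<in>edges G. e \<subseteq> verts G \<and> card e = 2)"

definition subgraph :: "'a graph \<Rightarrow> 'a graph \<Rightarrow> bool" where
  "subgraph H G \<longleftrightarrow> simple_graph H \<and> verts H \<subseteq> verts G \<and> edges H \<subseteq> edges G"

definition isomorphic :: "'a graph \<Rightarrow> 'b graph \<Rightarrow> bool" where
  "isomorphic G H \<longleftrightarrow>
     (\<exists>f. bij_betw f (verts G) (verts H) \<and>
          (\<forall>u\<in>verts G. \<forall>v\<in>verts G. {u, v} \<in> edges G \<longleftrightarrow> {f u, f v} \<in> edges H))"

datatype colour = Red | Blue

definition contains_mono ::
    "'a graph \<Rightarrow> ('a set \<Rightarrow> colour) \<Rightarrow> colour \<Rightarrow> 'b graph \<Rightarrow> bool" where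
  "contains_mono G c k H \<longleftrightarrow>
     (\<exists>S. subgraph S G \<and> (\<forall>e\<in>edges S. c e = k) \<and> isomorphic S H)"

text \<open>Colourings are total functions on sets of vertices; only their values on the edges of the
  host graph matter.\<close>

definition arrows :: "'a graph \<Rightarrow> 'b graph \<Rightarrow> 'c graph \<Rightarrow> bool" where
  "arrows G G\<^sub>1 G\<^sub>2 \<longleftrightarrow>
     (\<forall>c. contains_mono G c Red G\<^sub>1 \<or> contains_mono G c Blue G\<^sub>2)"

text \<open>Every finite graph is isomorphic to one with vertices in \<^typ>\<open>nat\<close>, so restricting
  the host graph to this vertex type loses no generality.\<close>

definition size_ramsey :: "'a graph \<Rightarrow> 'b graph \<Rightarrow> nat" where
  "size_ramsey G\<^sub>1 G\<^sub>2 =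
     (LEAST m. m > 0 \<and>
        (\<exists>G :: nat graph. simple_graph G \<and> card (edges G) = m \<and> arrows G G\<^sub>1 G\<^sub>2))"

definition complete_graph :: "nat \<Rightarrow> nat graph" where
  "complete_graph n = ({..<n}, {{i, j} | i j. i < n \<and> j < n \<and> i \<noteq> j})"

definition path_graph :: "nat \<Rightarrow> nat graph" where
  "path_graph m = ({..<m}, {{i, Suc i} | i. Suc i < m})"

definition copies :: "nat \<Rightarrow> 'a graph \<Rightarrow> (nat \<times> 'a) graph" where
  "copies n G = ({..<n} \<times> verts G, {Pair i ` e | i e. i < n \<and> e \<in> edges G})"

end

theory Submission
  imports Defs
begin

text \<open>
  Upper bound: a red subgraph without \<open>2K\<^sub>2\<close> meets at most one component of \<open>(n+1)P\<^sub>m\<close>, and for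
  \<open>m \<ge> 3\<close> it lies in two consecutive edges of the cycle on \<open>nm + 1\<close> vertices.

  Lower bound: colouring the star at \<open>v\<close> red shows that \<open>G - v\<close> contains \<open>nP\<^sub>m\<close> for every \<open>v\<close>.
  If \<open>G\<close> contains \<open>(n+1)P\<^sub>m\<close>, it has at least \<open>(n+1)(m-1)\<close> edges. Otherwise the maximum number of
  disjoint paths in each component is unchanged by deleting any vertex. A component packing
  \<open>k \<ge> 1\<close> paths then has at least \<open>km + 1\<close> vertices, hence at least \<open>km + 1\<close> edges if its
  minimum degree is at least 2. If it has a leaf, deleting the neighbour of the leaf makes the leaf
  useless too, so the component has at least \<open>km + 2\<close> vertices, and connectedness again yields
  \<open>km + 1\<close> edges.

  Of the paths only the facts that they are connected and have \<open>m\<close> vertices are needed for the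
  lower bound, so it holds for packings of connected \<open>m\<close>-sets.
\<close>

section \<open>Packings of connected sets\<close>

definition induced_edges :: "'a set set \<Rightarrow> 'a set \<Rightarrow> 'a set set" where
  "induced_edges E X = {e \<in> E. e \<subseteq> X}"

text \<open>Connectedness by cuts instead of walks: a proper part can be enlarged along an edge, and
  a failure yields at once a split with no edge across.\<close>

definition connected_in :: "'a set set \<Rightarrow> 'a set \<Rightarrow> bool" where
  "connected_in E S \<longleftrightarrow>
     (\<forall>A. A \<subset> S \<and> A \<noteq> {} \<longrightarrow> (\<exists>e\<in>E. e \<subseteq> S \<and> e \<inter> A \<noteq> {} \<and> \<not> e \<subseteq> A))"

definition packs :: "'a set set \<Rightarrow> nat \<Rightarrow> nat \<Rightarrow> 'a set \<Rightarrow> bool" where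
  "packs E m k X \<longleftrightarrow>
     (\<exists>F. finite F \<and> card F = k \<and> pairwise disjnt F \<and> \<Union>F \<subseteq> X \<and>
          (\<forall>S\<in>F. finite S \<and> card S = m \<and> connected_in E S))"

section \<open>Edge counts in connected sets and in sets of minimum degree 2\<close>

lemma finite_induced_edges: "finite E \<Longrightarrow> finite (induced_edges E X)"
  by (simp add: induced_edges_def)

lemma disjoint_induced_edges:
  assumes "{} \<notin> E" "A \<inter> B = {}"
  shows "induced_edges E A \<inter> induced_edges E B = {}"
proof -
  have "e = {}" if "e \<in> induced_edges E A \<inter> induced_edges E B" for e
    using that assms(2) by (auto simp: induced_edges_def)
  with assms(1) show ?thesis
    by (auto simp: induced_edges_def)
qed

lemma connected_inE:
  assumes "connected_in E S" "\<forall>e\<in>E. card e = 2" "A \<subset> S" "A \<noteq> {}"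
  obtains a b where "{a, b} \<in> E" "a \<in> A" "b \<in> S" "b \<notin> A"
proof -
  obtain e where e: "e \<in> E" "e \<subseteq> S" "e \<inter> A \<noteq> {}" "\<not> e \<subseteq> A"
    using assms(1,3,4) unfolding connected_in_def by meson
  obtain a b where ab: "a \<in> e" "a \<in> A" "b \<in> e" "b \<notin> A"
    using e by blast
  have "card e = 2"
    using e(1) assms(2) by blast
  then have "e = {a, b}"
    using ab by (auto simp: card_2_iff)
  with e(1,2) ab show thesis
    by (intro that[of a b]) auto
qed

text \<open>Spanning tree bound: a subset of \<open>S\<close> is grown one vertex at a time, and the
  cut condition supplies for each vertex after the first an edge that was not induced
  before.\<close>

lemma card_le_Suc_card_induced_edges:
  assumes "finite E" "\<forall>e\<in>E. card e = 2" "finite S" "connected_in E S"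
  shows "card S \<le> Suc (card (induced_edges E S))"
proof -
  have "\<exists>A\<subseteq>S. card A = k \<and> k \<le> Suc (card (induced_edges E A))" if "k \<le> card S" for k
    using that
  proof (induction k)
    case 0
    show ?case by (intro exI[of _ "{}"]) simp
  next
    case (Suc k)
    then obtain A where A: "A \<subseteq> S" "card A = k" "k \<le> Suc (card (induced_edges E A))"
      by auto
    have finA: "finite A"
      using A(1) assms(3) finite_subset by blast
    show ?case
    proof (cases "A = {}")
      case True
      then obtain x where "x \<in> S"
        using Suc.prems by fastforce
      then show ?thesis
        using True A by (intro exI[of _ "{x}"]) auto
    next
      case False
      have "A \<subset> S"
        using A Suc.prems by auto
      then obtain a b where ab: "{a, b} \<in> E" "a \<in> A" "b \<in> S" "b \<notin> A"
        using connected_inE assms False by metis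
      have "insert {a, b} (induced_edges E A) \<subseteq> induced_edges E (insert b A)"
        using ab by (auto simp: induced_edges_def)
      then have "card (insert {a, b} (induced_edges E A)) \<le> card (induced_edges E (insert b A))"
        by (intro card_mono finite_induced_edges assms)
      moreover have "{a, b} \<notin> induced_edges E A"
        using ab by (auto simp: induced_edges_def)
      ultimately have "Suc (card (induced_edges E A)) \<le> card (induced_edges E (insert b A))"
        using finite_induced_edges[OF assms(1)] by simp
      then show ?thesis
        using A ab finA by (intro exI[of _ "insert b A"]) auto
    qed
  qed
  from this[of "card S"] obtain A where "A \<subseteq> S" "card A = card S"
      "card S \<le> Suc (card (induced_edges E A))"
    by auto
  with card_subset_eq[OF assms(3)] show ?thesis
    by metis
qed

text \<open>Handshake: the degrees inside \<open>X\<close> sum to at least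
  \<open>2 * card X\<close>, and this sum counts every induced edge exactly twice.\<close>

lemma card_le_card_induced_edges_if_degree_ge_2:
  assumes "finite E" "\<forall>e\<in>E. card e = 2" "finite X"
    and deg: "\<forall>v\<in>X. 2 \<le> card {e \<in> induced_edges E X. v \<in> e}"
  shows "card X \<le> card (induced_edges E X)"
proof -
  let ?I = "induced_edges E X"
  have fin: "finite ?I"
    using assms(1) by (rule finite_induced_edges)
  have "{v \<in> X. v \<in> e} = e" if "e \<in> ?I" for e
    using that by (auto simp: induced_edges_def)
  then have two: "card {v \<in> X. v \<in> e} = 2" if "e \<in> ?I" for e
    using that assms(2) by (simp add: induced_edges_def)
  have "2 * card X = (\<Sum>v\<in>X. 2)"
    by simp
  also have "\<dots> \<le> (\<Sum>v\<in>X. card {e \<in> ?I. v \<in> e})"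
    using deg by (intro sum_mono) auto
  also have "\<dots> = (\<Sum>v\<in>X. \<Sum>e | e \<in> ?I \<and> v \<in> e. 1)"
    by simp
  also have "\<dots> = (\<Sum>e\<in>?I. \<Sum>v | v \<in> X \<and> v \<in> e. 1)"
    using assms(3) fin by (rule sum.swap_restrict)
  also have "\<dots> = (\<Sum>e\<in>?I. 2)"
    using two by (intro sum.cong) auto
  finally show ?thesis
    by simp
qed

section \<open>Combining, splitting and counting packings\<close>

lemma packsI:
  assumes "finite F" "pairwise disjnt F" "\<Union>F \<subseteq> X"
    and "\<And>S. S \<in> F \<Longrightarrow> finite S \<and> card S = m \<and> connected_in E S"
  shows "packs E m (card F) X"
  using assms unfolding packs_def by (intro exI[of _ F]) auto

lemma packs_subset: "packs E m k X \<Longrightarrow> X \<subseteq> Y \<Longrightarrow> packs E m k Y"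
  unfolding packs_def by (elim exE conjE, rule exI, intro conjI) (assumption | erule order_trans)+

lemma packs_le:
  assumes "packs E m k X" "j \<le> k"
  shows "packs E m j X"
proof -
  obtain F where F: "finite F" "card F = k" "pairwise disjnt F" "\<Union>F \<subseteq> X"
      "\<forall>S\<in>F. finite S \<and> card S = m \<and> connected_in E S"
    using assms unfolding packs_def by blast
  obtain F' where "F' \<subseteq> F" "card F' = j"
    using F assms(2) obtain_subset_with_card_n by metis
  then show ?thesis
    unfolding packs_def using F
    by (intro exI[of _ F']) (auto intro: finite_subset pairwise_subset)
qed

lemma packs_disjoint_Un:
  assumes "packs E m j A" "packs E m k B" "A \<inter> B = {}" "m \<ge> 1"
  shows "packs E m (j + k) (A \<union> B)"
proof -
  obtain F where F: "finite F" "card F = j" "pairwise disjnt F" "\<Union>F \<subseteq> A"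
      "\<forall>S\<in>F. finite S \<and> card S = m \<and> connected_in E S"
    using assms unfolding packs_def by blast
  obtain F' where F': "finite F'" "card F' = k" "pairwise disjnt F'" "\<Union>F' \<subseteq> B"
      "\<forall>S\<in>F'. finite S \<and> card S = m \<and> connected_in E S"
    using assms unfolding packs_def by blast
  have cross: "disjnt S T" if "S \<in> F" "T \<in> F'" for S T
    using that F(4) F'(4) assms(3) unfolding disjnt_def by blast
  \<comment> \<open>A common block would be disjoint from itself, hence empty, which
    \<open>m \<ge> 1\<close> rules out.\<close>
  have "F \<inter> F' = {}"
  proof (rule ccontr)
    assume "F \<inter> F' \<noteq> {}"
    then obtain S where "S \<in> F" "S \<in> F'"
      by blast
    then have "S = {}" "card S = m"
      using cross[of S S] F(5) by (auto simp: disjnt_def)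
    then show False
      using assms(4) by simp
  qed
  then have "card (F \<union> F') = j + k"
    using F F' by (simp add: card_Un_disjoint)
  moreover have "pairwise disjnt (F \<union> F')"
    using F(3) F'(3) cross by (auto simp: pairwise_def disjnt_sym)
  ultimately show ?thesis
    unfolding packs_def using F F' by (intro exI[of _ "F \<union> F'"]) auto
qed

lemma packs_card_le:
  assumes "packs E m k X" "finite X"
  shows "k * m \<le> card X"
proof -
  obtain F where F: "finite F" "card F = k" "pairwise disjnt F" "\<Union>F \<subseteq> X"
      "\<forall>S\<in>F. finite S \<and> card S = m \<and> connected_in E S"
    using assms unfolding packs_def by blast
  have "k * m = (\<Sum>S\<in>F. card S)"
    using F by simp
  also have "\<dots> = card (\<Union>F)"
    using F by (intro card_Union_disjoint[symmetric]) auto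
  also have "\<dots> \<le> card X"
    using F assms by (intro card_mono)
  finally show ?thesis .
qed

text \<open>Each block spans at least \<open>m - 1\<close> edges by the spanning tree bound, and
  disjoint blocks share no edge.\<close>

lemma packs_edges_le:
  assumes "packs E m k X" "finite E" "\<forall>e\<in>E. card e = 2"
  shows "k * (m - 1) \<le> card E"
proof -
  obtain F where F: "finite F" "card F = k" "pairwise disjnt F" "\<Union>F \<subseteq> X"
      "\<forall>S\<in>F. finite S \<and> card S = m \<and> connected_in E S"
    using assms unfolding packs_def by blast
  have "k * (m - 1) = (\<Sum>S\<in>F. m - 1)"
    using F by simp
  also have "\<dots> \<le> (\<Sum>S\<in>F. card (induced_edges E S))"
  proof (rule sum_mono)
    fix S assume "S \<in> F"
    then show "m - 1 \<le> card (induced_edges E S)"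
      using card_le_Suc_card_induced_edges[OF assms(2,3), of S] F(5) by auto
  qed
  also have "\<dots> = card (\<Union>S\<in>F. induced_edges E S)"
  proof (rule card_UN_disjoint[symmetric])
    show "\<forall>S\<in>F. \<forall>T\<in>F. S \<noteq> T \<longrightarrow> induced_edges E S \<inter> induced_edges E T = {}"
    proof (intro ballI impI)
      fix S T assume "S \<in> F" "T \<in> F" "S \<noteq> T"
      then have "S \<inter> T = {}"
        using F(3) by (auto simp: pairwise_def disjnt_def)
      moreover have "{} \<notin> E"
        using assms(3) by force
      ultimately show "induced_edges E S \<inter> induced_edges E T = {}"
        using disjoint_induced_edges by metis
    qed
  qed (use F finite_induced_edges assms in auto)
  also have "\<dots> \<le> card E"
    using assms(2) by (intro card_mono) (auto simp: induced_edges_def)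
  finally show ?thesis .
qed

text \<open>A connected block inside \<open>A \<union> B\<close> that met \<open>A\<close> without
  lying in it would have an edge leaving \<open>A\<close>. So every block lies in \<open>A\<close>
  or avoids it.\<close>

lemma packs_split:
  assumes "packs E m k X" and no_cross: "\<forall>e\<in>E. e \<subseteq> A \<union> B \<longrightarrow> e \<inter> A \<noteq> {} \<longrightarrow> e \<subseteq> A"
    and "X \<subseteq> A \<union> B"
  obtains i j where "i + j = k" "packs E m i (X \<inter> A)" "packs E m j (X \<inter> B)"
proof -
  obtain F where F: "finite F" "card F = k" "pairwise disjnt F" "\<Union>F \<subseteq> X"
      "\<forall>S\<in>F. finite S \<and> card S = m \<and> connected_in E S"
    using assms unfolding packs_def by blast
  define FA where "FA = {S \<in> F. S \<subseteq> A}"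
  define FB where "FB = {S \<in> F. \<not> S \<subseteq> A}"
  have "S \<inter> A = {}" if "S \<in> FB" for S
  proof (rule ccontr)
    assume "S \<inter> A \<noteq> {}"
    moreover have "S \<inter> A \<subset> S" "connected_in E S" "S \<subseteq> A \<union> B"
      using that F assms(3) unfolding FB_def by auto
    ultimately obtain e where "e \<in> E" "e \<subseteq> S" "e \<inter> (S \<inter> A) \<noteq> {}" "\<not> e \<subseteq> S \<inter> A"
      unfolding connected_in_def by meson
    with no_cross \<open>S \<subseteq> A \<union> B\<close> show False
      by blast
  qed
  then have "\<Union>FB \<subseteq> X \<inter> B"
    using F assms(3) unfolding FB_def by blast
  moreover have "\<Union>FA \<subseteq> X \<inter> A"
    using F unfolding FA_def by blast
  moreover have "FA \<subseteq> F" "FB \<subseteq> F"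
    by (auto simp: FA_def FB_def)
  moreover have "pairwise disjnt FA" "pairwise disjnt FB" "finite FA" "finite FB"
    using F(1,3) by (auto simp: FA_def FB_def pairwise_def)
  ultimately have "packs E m (card FA) (X \<inter> A)" "packs E m (card FB) (X \<inter> B)"
    using F(5) by (auto intro!: packsI)
  moreover have "card FA + card FB = k"
  proof -
    have "F = FA \<union> FB" "FA \<inter> FB = {}"
      by (auto simp: FA_def FB_def)
    then show ?thesis
      using F \<open>finite FA\<close> \<open>finite FB\<close> card_Un_disjoint by metis
  qed
  ultimately show thesis
    using that by blast
qed

section \<open>Packing numbers that survive the deletion of any vertex\<close>

definition packing_stable :: "'a set set \<Rightarrow> nat \<Rightarrow> nat \<Rightarrow> 'a set \<Rightarrow> bool" where
  "packing_stable E m k X \<longleftrightarrow>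
     packs E m k X \<and> \<not> packs E m (Suc k) X \<and> (\<forall>v\<in>X. packs E m k (X - {v}))"

text \<open>After \<open>v\<close> is deleted from \<open>A\<close>, a packing of size
  \<open>i + j\<close> splits into \<open>i'\<close> and \<open>j'\<close> blocks. As
  \<open>i + j\<close> is the packing number of the union, \<open>B\<close> holds at most
  \<open>j\<close> blocks, which leaves at least \<open>i\<close> for \<open>A - {v}\<close>.
  Swapping \<open>A\<close> and \<open>B\<close> serves the other side.\<close>

lemma packing_stable_split_left:
  assumes "packs E m i A" "packs E m j B" "packing_stable E m (i + j) (A \<union> B)"
    and "A \<inter> B = {}" "m \<ge> 1"
    and "\<forall>e\<in>E. e \<subseteq> A \<union> B \<longrightarrow> e \<inter> A \<noteq> {} \<longrightarrow> e \<subseteq> A"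
  shows "packing_stable E m i A"
  unfolding packing_stable_def
proof (intro conjI ballI)
  show "packs E m i A"
    by (fact assms(1))
next
  show "\<not> packs E m (Suc i) A"
    using packs_disjoint_Un[of E m "Suc i" A j B] assms unfolding packing_stable_def by auto
next
  fix v assume "v \<in> A"
  then have "packs E m (i + j) (A \<union> B - {v})"
    using assms unfolding packing_stable_def by blast
  then obtain i' j' where ij: "i' + j' = i + j" "packs E m i' ((A \<union> B - {v}) \<inter> A)"
      "packs E m j' ((A \<union> B - {v}) \<inter> B)"
    using packs_split[of E m "i + j" "A \<union> B - {v}" A B] assms(6) by blast
  have "j' \<le> j"
  proof (rule ccontr)
    assume "\<not> j' \<le> j"
    moreover have "packs E m j' B"
      using ij(3) packs_subset by (metis inf_le2)
    ultimately have "packs E m (Suc j) B"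
      using packs_le by (metis not_less_eq_eq)
    then have "packs E m (i + Suc j) (A \<union> B)"
      using assms packs_disjoint_Un by metis
    then show False
      using assms(3) unfolding packing_stable_def by simp
  qed
  then have "i \<le> i'"
    using ij(1) by linarith
  moreover have "(A \<union> B - {v}) \<inter> A = A - {v}"
    by blast
  ultimately show "packs E m i (A - {v})"
    using ij(2) packs_le by metis
qed

text \<open>One spare vertex is enough for the degree bound. The tree bound, weaker by one edge,
  needs two, and a leaf together with its neighbour provides them.\<close>

lemma packing_stable_connected_edges:
  assumes "finite E" "\<forall>e\<in>E. card e = 2" "m \<ge> 2" "k \<ge> 1"
    and "finite X" "packing_stable E m k X" "connected_in E X"
  shows "k * m + 1 \<le> card (induced_edges E X)"
proof -
  let ?I = "induced_edges E X"
  have "2 \<le> k * m"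
    using assms(3,4) mult_le_mono[of 1 k 2 m] by simp
  then have "X \<noteq> {}"
    using packs_card_le[of E m k X] assms unfolding packing_stable_def by auto
  \<comment> \<open>Deleting \<open>w\<close> leaves room for \<open>k\<close> blocks, so
    \<open>X\<close> has a vertex beyond \<open>k * m\<close> others.\<close>
  then obtain w where "w \<in> X"
    by blast
  then have "k * m \<le> card (X - {w})" "card X = Suc (card (X - {w}))"
    using packs_card_le[of E m k "X - {w}"] assms card_Suc_Diff1[of X w]
    unfolding packing_stable_def by auto
  then have cX: "k * m + 1 \<le> card X"
    by simp
  show ?thesis
  proof (cases "\<forall>v\<in>X. 2 \<le> card {e \<in> ?I. v \<in> e}")
    case True
    then show ?thesis
      using card_le_card_induced_edges_if_degree_ge_2[OF assms(1,2,5)] cX by linarith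
  next
    case False
    then obtain v where v: "v \<in> X" "card {e \<in> ?I. v \<in> e} < 2"
      by auto
    \<comment> \<open>Connectedness gives the low-degree vertex \<open>v\<close> a neighbour, so its
      degree is exactly 1.\<close>
    have "{v} \<subset> X"
      using v(1) cX \<open>2 \<le> k * m\<close> by (cases "X = {v}") auto
    then obtain u where u: "{v, u} \<in> E" "u \<in> X" "u \<noteq> v"
      using connected_inE[OF assms(7,2), of "{v}"] by blast
    have vu: "{v, u} \<in> {e \<in> ?I. v \<in> e}"
      using u v by (auto simp: induced_edges_def)
    have only: "e = {v, u}" if "e \<in> ?I" "v \<in> e" for e
    proof (rule ccontr)
      assume "e \<noteq> {v, u}"
      then have "2 = card {e, {v, u}}"
        by simp
      also have "\<dots> \<le> card {e \<in> ?I. v \<in> e}"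
        using that vu finite_induced_edges[OF assms(1), of X] by (intro card_mono) auto
      finally show False
        using v(2) by simp
    qed
    obtain F where F: "finite F" "card F = k" "pairwise disjnt F" "\<Union>F \<subseteq> X - {u}"
        "\<forall>S\<in>F. finite S \<and> card S = m \<and> connected_in E S"
      using assms(6) u(2) unfolding packing_stable_def packs_def by blast
    \<comment> \<open>A block through \<open>v\<close> has a second vertex as
      \<open>m \<ge> 2\<close>, so it needs the only edge at \<open>v\<close> and with it the
      deleted \<open>u\<close>.\<close>
    have "v \<notin> S" if "S \<in> F" for S
    proof
      assume "v \<in> S"
      moreover have "S \<noteq> {v}" "connected_in E S"
        using F(5) that assms(3) by auto
      ultimately obtain b where b: "{v, b} \<in> E" "b \<in> S"
        using connected_inE[of E S "{v}"] assms(2) by blast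
      then have "{v, b} \<in> ?I"
        using F(4) that v(1) by (auto simp: induced_edges_def)
      then have "u \<in> {v, b}"
        using only by blast
      then show False
        using b(2) u(3) F(4) that by blast
    qed
    then have "\<Union>F \<subseteq> X - {u, v}"
      using F(4) by blast
    then have "packs E m k (X - {u, v})"
      unfolding packs_def using F by blast
    then have "k * m \<le> card (X - {u, v})"
      using packs_card_le assms(5) by blast
    moreover have "card (X - {u, v}) = card X - 2" "card X \<ge> 2"
      using u v assms(5) card_mono[of X "{u, v}"] by (simp_all add: card_Diff_subset)
    ultimately have "k * m + 2 \<le> card X"
      by linarith
    then show ?thesis
      using card_le_Suc_card_induced_edges[OF assms(1,2,5,7)] by linarith
  qed
qed

text \<open>Induction on \<open>X\<close>: a disconnected \<open>X\<close> splits into two sides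
  without edges across; both sides are stable and their edge sets are disjoint, so the bounds add
  up.\<close>

lemma packing_stable_edges:
  assumes "finite E" "\<forall>e\<in>E. card e = 2" "m \<ge> 2" "k \<ge> 1"
    and "finite X" "packing_stable E m k X"
  shows "k * m + 1 \<le> card (induced_edges E X)"
  using assms(5,4,6)
proof (induction X arbitrary: k rule: finite_psubset_induct)
  case (psubset X)
  show ?case
  proof (cases "connected_in E X")
    case True
    then show ?thesis
      using psubset.prems psubset.hyps assms(1-3) by (intro packing_stable_connected_edges)
  next
    case False
    then obtain A where A: "A \<subset> X" "A \<noteq> {}"
        "\<forall>e\<in>E. e \<subseteq> X \<longrightarrow> e \<inter> A \<noteq> {} \<longrightarrow> e \<subseteq> A"
      unfolding connected_in_def by meson
    define B where "B = X - A"
    have AB: "A \<union> B = X" "A \<inter> B = {}" "B \<subset> X"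
      using A unfolding B_def by auto
    have crossA: "\<forall>e\<in>E. e \<subseteq> A \<union> B \<longrightarrow> e \<inter> A \<noteq> {} \<longrightarrow> e \<subseteq> A"
      using A(3) AB(1) by simp
    then have crossB: "\<forall>e\<in>E. e \<subseteq> B \<union> A \<longrightarrow> e \<inter> B \<noteq> {} \<longrightarrow> e \<subseteq> B"
      using AB(2) by blast
    have "packs E m k X"
      using psubset.prems unfolding packing_stable_def by blast
    then obtain i j where "i + j = k" "packs E m i (X \<inter> A)" "packs E m j (X \<inter> B)"
      using packs_split[OF _ crossA] AB(1) by (metis order_refl)
    moreover have "X \<inter> A = A" "X \<inter> B = B"
      using AB by auto
    ultimately have ij: "i + j = k" "packs E m i A" "packs E m j B"
      by auto
    have "packing_stable E m i A"
      using packing_stable_split_left[OF ij(2,3) _ AB(2) _ crossA] ij(1) AB(1) psubset.prems assms(3)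
      by simp
    then have eA: "i \<ge> 1 \<Longrightarrow> i * m + 1 \<le> card (induced_edges E A)"
      using psubset.IH A(1) by blast
    have "packing_stable E m j B"
      using packing_stable_split_left[OF ij(3,2) _ _ _ crossB] ij(1) AB psubset.prems assms(3)
      by (simp add: Un_commute Int_commute add.commute)
    then have eB: "j \<ge> 1 \<Longrightarrow> j * m + 1 \<le> card (induced_edges E B)"
      using psubset.IH AB(3) by blast
    have "{} \<notin> E"
      using assms(2) by force
    then have "induced_edges E A \<inter> induced_edges E B = {}"
      using disjoint_induced_edges AB(2) by metis
    then have "card (induced_edges E A) + card (induced_edges E B) =
        card (induced_edges E A \<union> induced_edges E B)"
      using finite_induced_edges[OF assms(1)] by (metis card_Un_disjoint)
    also have "\<dots> \<le> card (induced_edges E X)"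
      using AB(1) by (intro card_mono finite_induced_edges assms) (auto simp: induced_edges_def)
    finally have le: "card (induced_edges E A) + card (induced_edges E B) \<le> card (induced_edges E X)" .
    have km: "k * m = i * m + j * m"
      using ij(1) by (auto simp: add_mult_distrib)
    \<comment> \<open>A side with packing number 0 has no inductive bound, but since
      \<open>k \<ge> 1\<close> at least one side does.\<close>
    show ?thesis
    proof (cases "i = 0")
      case True
      then show ?thesis
        using eB le km ij(1) psubset.prems(1) by auto
    next
      case False
      then show ?thesis
        using eA eB le km by (cases "j = 0") auto
    qed
  qed
qed

text \<open>If \<open>V\<close> packs a further block, counting edges block by block gives the
  second term. Otherwise \<open>n\<close> is the packing number of \<open>V\<close>, avoidance makes
  it stable, and the first term follows.\<close>

theorem edges_ge_if_packs_avoiding_any_vertex: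
  assumes "finite E" "finite V" "\<forall>e\<in>E. card e = 2" "m \<ge> 2" "n \<ge> 1"
    and avoid: "\<And>v. packs E m n (V - {v})"
  shows "min (n * m + 1) ((n + 1) * (m - 1)) \<le> card E"
proof (cases "packs E m (Suc n) V")
  case True
  then have "(n + 1) * (m - 1) \<le> card E"
    using packs_edges_le assms(1,3) by fastforce
  then show ?thesis
    by simp
next
  case False
  then have "packing_stable E m n V"
    unfolding packing_stable_def using avoid packs_subset by (metis Diff_subset)
  then have "n * m + 1 \<le> card (induced_edges E V)"
    using packing_stable_edges assms by blast
  also have "\<dots> \<le> card E"
    using assms(1) by (intro card_mono) (auto simp: induced_edges_def)
  finally show ?thesis
    by simp
qed

section \<open>Monochromatic copies of disjoint paths\<close>

text \<open>Makes the matching an instance of \<open>copies n (path_graph m)\<close>, so one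
  characterisation serves both colours.\<close>

lemma complete_graph_2: "complete_graph 2 = path_graph 2"
proof -
  have "{{i, j} | i j. i < 2 \<and> j < 2 \<and> i \<noteq> j} = {{i, Suc i} | i. Suc i < 2}"
    by (auto simp: less_2_cases_iff insert_commute)
  then show ?thesis
    by (simp add: complete_graph_def path_graph_def)
qed

lemma edges_copies_path_graph:
  "edges (copies n (path_graph m)) = {{(i, j), (i, Suc j)} | i j. i < n \<and> Suc j < m}"
proof -
  have "edges (copies n (path_graph m)) = {Pair i ` {j, Suc j} | i j. i < n \<and> Suc j < m}"
    unfolding copies_def path_graph_def snd_conv by blast
  then show ?thesis
    by simp
qed

lemma verts_copies_path_graph: "verts (copies n (path_graph m)) = {..<n} \<times> {..<m}"
  by (simp add: copies_def path_graph_def)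

text \<open>Trades subgraph and isomorphism for one injective labelling: \<open>p (i, j)\<close> is
  the vertex at position \<open>j\<close> of path \<open>i\<close>. From left to right,
  \<open>p\<close> inverts the isomorphism.\<close>

lemma contains_mono_copies_path_graph_iff:
  assumes "simple_graph G" "m \<ge> 2"
  shows "contains_mono G c k (copies n (path_graph m)) \<longleftrightarrow>
    (\<exists>p. inj_on p ({..<n} \<times> {..<m}) \<and>
      (\<forall>i<n. \<forall>j. Suc j < m \<longrightarrow>
        {p (i, j), p (i, Suc j)} \<in> edges G \<and> c {p (i, j), p (i, Suc j)} = k))"
    (is "?L \<longleftrightarrow> ?R")
proof
  let ?H = "copies n (path_graph m)"
  assume ?L
  then obtain S f where S: "subgraph S G" "\<forall>e\<in>edges S. c e = k"
    and f: "bij_betw f (verts S) (verts ?H)"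
      "\<forall>u\<in>verts S. \<forall>v\<in>verts S. {u, v} \<in> edges S \<longleftrightarrow> {f u, f v} \<in> edges ?H"
    unfolding contains_mono_def isomorphic_def by blast
  define p where "p = inv_into (verts S) f"
  have p: "bij_betw p (verts ?H) (verts S)"
    unfolding p_def using f(1) by (rule bij_betw_inv_into)
  have "{p (i, j), p (i, Suc j)} \<in> edges S" if "i < n" "Suc j < m" for i j
  proof -
    have H: "(i, j) \<in> verts ?H" "(i, Suc j) \<in> verts ?H"
      using that by (auto simp: verts_copies_path_graph)
    then have "f (p (i, j)) = (i, j)" "f (p (i, Suc j)) = (i, Suc j)"
      unfolding p_def using f(1) by (meson bij_betw_inv_into_right)+
    moreover have "p (i, j) \<in> verts S" "p (i, Suc j) \<in> verts S"
      using H p by (auto simp: bij_betw_def)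
    moreover have "{(i, j), (i, Suc j)} \<in> edges ?H"
      unfolding edges_copies_path_graph using that by blast
    ultimately show ?thesis
      using f(2) by simp
  qed
  moreover have "inj_on p ({..<n} \<times> {..<m})"
    using p unfolding verts_copies_path_graph bij_betw_def by blast
  ultimately show ?R
    using S unfolding subgraph_def by blast
next
  let ?H = "copies n (path_graph m)"
  let ?D = "{..<n} \<times> {..<m}"
  assume ?R
  then obtain p where inj: "inj_on p ?D"
    and p: "\<And>i j. i < n \<Longrightarrow> Suc j < m \<Longrightarrow> {p (i, j), p (i, Suc j)} \<in> edges G"
      "\<And>i j. i < n \<Longrightarrow> Suc j < m \<Longrightarrow> c {p (i, j), p (i, Suc j)} = k"
    by blast
  \<comment> \<open>Only images of path edges enter \<open>S\<close>: an induced subgraph of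
    \<open>G\<close> could have more edges, and \<open>isomorphic\<close> must also reflect
    edges.\<close>
  define S where "S = (p ` ?D, (\<lambda>e. p ` e) ` edges ?H)"
  have eS: "edges S = {{p (i, j), p (i, Suc j)} | i j. i < n \<and> Suc j < m}"
  proof -
    have "edges ?H = (\<lambda>(i, j). {(i, j), (i, Suc j)}) ` {(i, j). i < n \<and> Suc j < m}"
      unfolding edges_copies_path_graph by auto
    then show ?thesis
      by (auto simp: S_def image_image)
  qed
  have eSG: "edges S \<subseteq> edges G"
    using p(1) unfolding eS by blast
  \<comment> \<open>Every position has a successor or, since \<open>m \<ge> 2\<close>, a predecessor
    on its path, so it lies on an edge of \<open>G\<close>.\<close>
  have "p (i, j) \<in> verts G" if "i < n" "j < m" for i j
  proof -
    have "\<exists>e\<in>edges G. p (i, j) \<in> e"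
    proof (cases "Suc j < m")
      case True
      then show ?thesis using p(1) that by blast
    next
      case False
      then have "Suc (j - 1) < m" "Suc (j - 1) = j"
        using that assms(2) by auto
      then show ?thesis using p(1)[of i "j - 1"] that by auto
    qed
    then show ?thesis
      using assms(1) unfolding simple_graph_def by blast
  qed
  then have vSG: "verts S \<subseteq> verts G"
    by (auto simp: S_def)
  have "e \<subseteq> verts S" if "e \<in> edges S" for e
    using that unfolding eS by (auto simp: S_def)
  then have "simple_graph S"
    using assms(1) eSG by (auto simp: simple_graph_def S_def)
  then have "subgraph S G"
    using vSG eSG by (simp add: subgraph_def)
  moreover have "\<forall>e\<in>edges S. c e = k"
    using p(2) unfolding eS by blast
  moreover have "isomorphic S ?H"
    unfolding isomorphic_def
  proof (intro exI[of _ "inv_into ?D p"] conjI ballI)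
    have "bij_betw p ?D (verts S)"
      using inj by (simp add: S_def bij_betw_def)
    then show "bij_betw (inv_into ?D p) (verts S) (verts ?H)"
      unfolding verts_copies_path_graph by (rule bij_betw_inv_into)
  next
    fix u v assume "u \<in> verts S" "v \<in> verts S"
    then obtain x y where xy: "x \<in> ?D" "u = p x" "y \<in> ?D" "v = p y"
      unfolding S_def by auto
    have img: "p ` e = p ` {x, y} \<longleftrightarrow> e = {x, y}" if "e \<in> edges ?H" for e
    proof (rule inj_on_image_eq_iff[OF inj])
      show "e \<subseteq> ?D"
        using that unfolding edges_copies_path_graph by auto
      show "{x, y} \<subseteq> ?D"
        using xy by blast
    qed
    have "p ` {x, y} \<in> (\<lambda>e. p ` e) ` edges ?H \<longleftrightarrow> {x, y} \<in> edges ?H"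
    proof
      assume "p ` {x, y} \<in> (\<lambda>e. p ` e) ` edges ?H"
      then obtain e where "p ` {x, y} = p ` e" "e \<in> edges ?H"
        by (rule imageE)
      then show "{x, y} \<in> edges ?H"
        using img[of e] by simp
    qed (rule imageI)
    then show "{u, v} \<in> edges S \<longleftrightarrow> {inv_into ?D p u, inv_into ?D p v} \<in> edges ?H"
      using xy inj by (simp add: S_def inv_into_f_f)
  qed
  ultimately show ?L
    unfolding contains_mono_def by blast
qed

lemma contains_mono_2K2_iff:
  assumes "simple_graph G"
  shows "contains_mono G c k (copies 2 (complete_graph 2)) \<longleftrightarrow>
    (\<exists>e\<in>edges G. \<exists>e'\<in>edges G. c e = k \<and> c e' = k \<and> e \<inter> e' = {})"
    (is "?L \<longleftrightarrow> ?R")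
proof
  assume ?L
  then obtain p where inj: "inj_on p ({..<2::nat} \<times> {..<2::nat})"
    and p: "\<forall>i<2. \<forall>j. Suc j < 2 \<longrightarrow>
        {p (i, j), p (i, Suc j)} \<in> edges G \<and> c {p (i, j), p (i, Suc j)} = k"
    using contains_mono_copies_path_graph_iff[OF assms, of 2 c k 2] by (auto simp: complete_graph_2)
  have "{p (0, 0), p (0, 1)} \<inter> {p (1, 0), p (1, 1)} = {}"
    using inj_on_eq_iff[OF inj] by auto
  then show ?R
    using p[rule_format, of 0 0] p[rule_format, of 1 0] by (metis One_nat_def lessI numeral_2_eq_2 zero_less_Suc)
next
  assume ?R
  then obtain e e' where e: "e \<in> edges G" "e' \<in> edges G" "c e = k" "c e' = k" "e \<inter> e' = {}"
    by blast
  then have "card e = 2" "card e' = 2"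
    using assms by (auto simp: simple_graph_def)
  then obtain a b a' b' where ab: "e = {a, b}" "a \<noteq> b" "e' = {a', b'}" "a' \<noteq> b'"
    by (auto simp: card_2_iff)
  define p where "p = (\<lambda>(i::nat, j::nat). if i = 0 then (if j = 0 then a else b)
    else (if j = 0 then a' else b'))"
  have "inj_on p ({..<2} \<times> {..<2})"
    using ab e(5) by (auto simp: inj_on_def p_def less_2_cases_iff)
  moreover have "\<forall>i<2. \<forall>j. Suc j < 2 \<longrightarrow>
        {p (i, j), p (i, Suc j)} \<in> edges G \<and> c {p (i, j), p (i, Suc j)} = k"
    using ab e by (auto simp: p_def)
  ultimately show ?L
    using contains_mono_copies_path_graph_iff[OF assms, of 2 c k 2] by (auto simp: complete_graph_2)
qed

section \<open>Lower bound\<close>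

text \<open>Membership in a nonempty proper part must change between two consecutive positions; the
  edge joining them crosses the cut.\<close>

lemma connected_in_path:
  assumes "\<And>j. Suc j < m \<Longrightarrow> {q j, q (Suc j)} \<in> E"
  shows "connected_in E (q ` {..<m})"
  unfolding connected_in_def
proof (intro allI impI)
  fix A assume A: "A \<subset> q ` {..<m} \<and> A \<noteq> {}"
  have "\<exists>j. Suc j < m \<and> (q j \<in> A) \<noteq> (q (Suc j) \<in> A)"
  proof (rule ccontr)
    assume "\<nexists>j. Suc j < m \<and> (q j \<in> A) \<noteq> (q (Suc j) \<in> A)"
    then have "(q j \<in> A) = (q 0 \<in> A)" if "j < m" for j
      using that by (induction j) auto
    then have "A = (if q 0 \<in> A then q ` {..<m} else {})"
      using A by auto
    then show False
      using A by (auto split: if_splits)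
  qed
  then obtain j where "Suc j < m" "(q j \<in> A) \<noteq> (q (Suc j) \<in> A)"
    by blast
  then show "\<exists>e\<in>E. e \<subseteq> q ` {..<m} \<and> e \<inter> A \<noteq> {} \<and> \<not> e \<subseteq> A"
    using assms[of j] by (intro bexI[of _ "{q j, q (Suc j)}"]) auto
qed

text \<open>With the star at \<open>v\<close> coloured red, any two red edges meet in
  \<open>v\<close>, so there is a blue copy. Its edges avoid \<open>v\<close>, and each of its
  vertices lies on such an edge.\<close>

lemma arrows_packs:
  assumes "simple_graph G" "m \<ge> 2"
    and "arrows G (copies 2 (complete_graph 2)) (copies n (path_graph m))"
  shows "packs (edges G) m n (verts G - {v})"
proof -
  let ?c = "\<lambda>e. if v \<in> e then Red else Blue"
  have "\<not> contains_mono G ?c Red (copies 2 (complete_graph 2))"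
    unfolding contains_mono_2K2_iff[OF assms(1)] by auto
  then have "contains_mono G ?c Blue (copies n (path_graph m))"
    using assms(3) unfolding arrows_def by blast
  then obtain p where inj: "inj_on p ({..<n} \<times> {..<m})"
    and p: "\<And>i j. i < n \<Longrightarrow> Suc j < m \<Longrightarrow> {p (i, j), p (i, Suc j)} \<in> edges G"
      "\<And>i j. i < n \<Longrightarrow> Suc j < m \<Longrightarrow> v \<notin> {p (i, j), p (i, Suc j)}"
    unfolding contains_mono_copies_path_graph_iff[OF assms(1,2)]
    by (auto split: if_splits)
  define P where "P i = (\<lambda>j. p (i, j)) ` {..<m}" for i
  have disj: "P i \<inter> P i' = {}" if "i < n" "i' < n" "i \<noteq> i'" for i i'
    using that inj unfolding P_def by (auto simp: inj_on_def)
  have cP: "card (P i) = m" if "i < n" for i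
    unfolding P_def using that inj by (subst card_image) (auto simp: inj_on_def)
  \<comment> \<open>\<open>packs\<close> uses a set of blocks, so different indices must give
    different blocks; being disjoint and nonempty, they do.\<close>
  have "inj_on P {..<n}"
  proof (rule inj_onI)
    fix i i' assume "i \<in> {..<n}" "i' \<in> {..<n}" "P i = P i'"
    moreover have "P i \<noteq> {}"
      using cP[of i] \<open>i \<in> {..<n}\<close> assms(2) by auto
    ultimately show "i = i'"
      using disj[of i i'] by auto
  qed
  then have "card (P ` {..<n}) = n"
    by (simp add: card_image)
  moreover have "pairwise disjnt (P ` {..<n})"
    using disj by (auto simp: pairwise_def disjnt_def)
  moreover have "p (i, j) \<in> verts G - {v}" if "i < n" "j < m" for i j
  proof -
    have "\<exists>e\<in>edges G. p (i, j) \<in> e \<and> v \<notin> e"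
    proof (cases "Suc j < m")
      case True
      then show ?thesis using p[of i j] that by blast
    next
      case False
      then have "Suc (j - 1) < m" "Suc (j - 1) = j"
        using that assms(2) by auto
      then show ?thesis using p[of i "j - 1"] that by (metis insertCI)
    qed
    then show ?thesis
      using assms(1) unfolding simple_graph_def by blast
  qed
  then have "\<Union>(P ` {..<n}) \<subseteq> verts G - {v}"
    unfolding P_def by blast
  moreover have "connected_in (edges G) (P i)" if "i < n" for i
    unfolding P_def using p(1) that by (intro connected_in_path)
  ultimately show ?thesis
    unfolding packs_def using cP by (intro exI[of _ "P ` {..<n}"]) (auto simp: P_def)
qed

lemma finite_edges: "simple_graph G \<Longrightarrow> finite (edges G)"
  unfolding simple_graph_def by (rule finite_subset[of _ "Pow (verts G)"]) auto

lemma arrows_edges_ge: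
  assumes "simple_graph G" "n \<ge> 1" "m \<ge> 2"
    and "arrows G (copies 2 (complete_graph 2)) (copies n (path_graph m))"
  shows "min (n * m + 1) ((n + 1) * (m - 1)) \<le> card (edges G)"
proof (rule edges_ge_if_packs_avoiding_any_vertex)
  show "packs (edges G) m n (verts G - {v})" for v
    using assms(1,3,4) by (rule arrows_packs)
  show "finite (edges G)"
    using assms(1) by (rule finite_edges)
qed (use assms(1-3) in \<open>simp_all add: simple_graph_def\<close>)

section \<open>Upper bound\<close>

text \<open>For a host graph it remains to treat colourings whose red edges pairwise meet.\<close>

lemma arrowsI:
  assumes "simple_graph G" "m \<ge> 2"
    and "\<And>c :: nat set \<Rightarrow> colour.
      (\<And>e e'. e \<in> edges G \<Longrightarrow> e' \<in> edges G \<Longrightarrow> c e = Red \<Longrightarrow> c e' = Red \<Longrightarrow> e \<inter> e' \<noteq> {}) \<Longrightarrow>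
      \<exists>p. inj_on p ({..<n} \<times> {..<m}) \<and>
        (\<forall>i<n. \<forall>j. Suc j < m \<longrightarrow>
          {p (i, j), p (i, Suc j)} \<in> edges G \<and> c {p (i, j), p (i, Suc j)} = Blue)"
  shows "arrows G (copies 2 (complete_graph 2)) (copies n (path_graph m))"
  unfolding arrows_def contains_mono_2K2_iff[OF assms(1)]
    contains_mono_copies_path_graph_iff[OF assms(1,2)]
proof
  fix c
  show "(\<exists>e\<in>edges G. \<exists>e'\<in>edges G. c e = Red \<and> c e' = Red \<and> e \<inter> e' = {}) \<or>
    (\<exists>p. inj_on p ({..<n} \<times> {..<m}) \<and>
      (\<forall>i<n. \<forall>j. Suc j < m \<longrightarrow>
        {p (i, j), p (i, Suc j)} \<in> edges G \<and> c {p (i, j), p (i, Suc j)} = Blue))"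
    (is "?R \<or> ?B")
  proof (cases ?R)
    case False
    then have "?B"
      by (intro assms(3)) blast
    then show ?thesis ..
  qed blast
qed

section \<open>The host made of \<open>n + 1\<close> disjoint paths\<close>

lemma not_Red_iff: "k \<noteq> Red \<longleftrightarrow> k = Blue"
  by (cases k) auto

text \<open>Uniqueness of quotient and remainder: \<open>i * m + j\<close> can encode position
  \<open>j\<close> of path \<open>i\<close>.\<close>

lemma mult_add_eq_iff:
  fixes i j i' j' m :: nat
  assumes "j < m" "j' < m"
  shows "i * m + j = i' * m + j' \<longleftrightarrow> i = i' \<and> j = j'"
proof
  assume eq: "i * m + j = i' * m + j'"
  have "(i * m + j) div m = i" "(i' * m + j') div m = i'"
    using assms by auto
  with eq show "i = i' \<and> j = j'"
    by auto
qed simp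

text \<open>Pairwise meeting red edges lie in a single path, and the other \<open>n\<close> paths
  are entirely blue.\<close>

lemma disjoint_paths_arrow:
  assumes "m \<ge> 2"
  shows "\<exists>G :: nat graph. simple_graph G \<and> card (edges G) = (n + 1) * (m - 1) \<and>
    arrows G (copies 2 (complete_graph 2)) (copies n (path_graph m))"
proof -
  define ed where "ed = (\<lambda>(i, j). {i * m + j, Suc (i * m + j)})"
  \<comment> \<open>The bound \<open>m - 1\<close> omits the edge from the last vertex of a path to
    the first of the next.\<close>
  define D where "D = {..<n + 1} \<times> {..<m - 1}"
  define G :: "nat graph" where "G = ({..<(n + 1) * m}, ed ` D)"
  have bound: "i * m + j < (n + 1) * m" if "i \<le> n" "j < m" for i j
  proof -
    have "i * m + j < i * m + m"
      using that by simp
    also have "\<dots> = (i + 1) * m"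
      by simp
    also have "\<dots> \<le> (n + 1) * m"
      using that by (intro mult_le_mono) auto
    finally show ?thesis .
  qed
  have simple: "simple_graph G"
    unfolding simple_graph_def
  proof (intro conjI ballI)
    fix e assume "e \<in> edges G"
    then obtain i j where "(i, j) \<in> D" "e = ed (i, j)"
      by (auto simp: G_def)
    then have ij: "i \<le> n" "Suc j < m" "e = {i * m + j, Suc (i * m + j)}"
      by (auto simp: D_def ed_def)
    then show "card e = 2"
      by simp
    show "e \<subseteq> verts G"
      using ij bound[of i j] bound[of i "Suc j"] by (auto simp: G_def)
  qed (simp add: G_def)
  have "inj_on ed D"
  proof (rule inj_onI)
    fix x y assume "x \<in> D" "y \<in> D" "ed x = ed y"
    moreover obtain i j i' j' where xy: "x = (i, j)" "y = (i', j')"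
      by (cases x, cases y)
    ultimately have *: "j < m" "j' < m"
        "{i * m + j, Suc (i * m + j)} = {i' * m + j', Suc (i' * m + j')}"
      by (auto simp: D_def ed_def)
    then have "i * m + j = i' * m + j'"
      by (auto simp: doubleton_eq_iff)
    then show "x = y"
      using * xy mult_add_eq_iff by simp
  qed
  then have card: "card (edges G) = (n + 1) * (m - 1)"
    by (simp add: G_def card_image D_def)
  have "arrows G (copies 2 (complete_graph 2)) (copies n (path_graph m))"
  proof (rule arrowsI[OF simple assms])
    fix c :: "nat set \<Rightarrow> colour"
    assume red: "\<And>e e'. e \<in> edges G \<Longrightarrow> e' \<in> edges G \<Longrightarrow> c e = Red \<Longrightarrow> c e' = Red \<Longrightarrow> e \<inter> e' \<noteq> {}"
    have edge: "ed (i, j) \<in> edges G" if "i \<le> n" "Suc j < m" for i j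
      using that by (auto simp: G_def D_def)
    \<comment> \<open>Both ends of an edge have the index of its path as quotient by
      \<open>m\<close>, so a shared vertex forces equal indices.\<close>
    have same: "i = i'" if "i \<le> n" "i' \<le> n" "Suc j < m" "Suc j' < m" "c (ed (i, j)) = Red"
      "c (ed (i', j')) = Red" for i j i' j'
    proof -
      have "ed (i, j) \<inter> ed (i', j') \<noteq> {}"
        using red edge that by blast
      then have "i * m + j = i' * m + j' \<or> i * m + j = i' * m + Suc j' \<or>
          i * m + Suc j = i' * m + j' \<or> i * m + Suc j = i' * m + Suc j'"
        by (auto simp: ed_def)
      then show ?thesis
        using mult_add_eq_iff that by (metis Suc_lessD)
    qed
    \<comment> \<open>\<open>r\<close> is the path to discard; without red edges any
      \<open>r\<close> will do.\<close>
    have "\<exists>r. \<forall>i j. i \<le> n \<longrightarrow> Suc j < m \<longrightarrow> i \<noteq> r \<longrightarrow> c (ed (i, j)) \<noteq> Red"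
    proof (cases "\<exists>r j. r \<le> n \<and> Suc j < m \<and> c (ed (r, j)) = Red")
      case True
      then obtain r j where "r \<le> n" "Suc j < m" "c (ed (r, j)) = Red"
        by blast
      then show ?thesis
        using same by (intro exI[of _ r]) blast
    qed blast
    then obtain r where blue: "\<And>i j. i \<le> n \<Longrightarrow> i \<noteq> r \<Longrightarrow> Suc j < m \<Longrightarrow> c (ed (i, j)) = Blue"
      unfolding not_Red_iff by blast
    \<comment> \<open>Renumbers the paths by skipping index \<open>r\<close>.\<close>
    define s where "s i = (if i < r then i else Suc i)" for i
    have s: "s i \<le> n" "s i \<noteq> r" if "i < n" for i
      using that by (auto simp: s_def)
    have inj_s: "s i = s i' \<longleftrightarrow> i = i'" for i i'
      by (auto simp: s_def)
    let ?p = "\<lambda>(i, j). s i * m + j"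
    have "inj_on ?p ({..<n} \<times> {..<m})"
      by (auto simp: inj_on_def mult_add_eq_iff inj_s)
    moreover have "{?p (i, j), ?p (i, Suc j)} = ed (s i, j)" for i j
      by (simp add: ed_def)
    ultimately show "\<exists>p. inj_on p ({..<n} \<times> {..<m}) \<and>
        (\<forall>i<n. \<forall>j. Suc j < m \<longrightarrow>
          {p (i, j), p (i, Suc j)} \<in> edges G \<and> c {p (i, j), p (i, Suc j)} = Blue)"
      using s blue edge by (intro exI[of _ ?p]) (simp add: ed_def)
  qed
  with simple card show ?thesis
    by blast
qed

section \<open>The cycle on \<open>n * m + 1\<close> vertices as host\<close>

lemma mod_neq_if_close:
  fixes a b N :: nat
  assumes "a < b" "b < a + N"
  shows "a mod N \<noteq> b mod N"
proof
  assume "a mod N = b mod N"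
  then have "N dvd b - a"
    using assms(1) mod_eq_dvd_iff_nat[of a b N] by auto
  then show False
    using assms by (auto dest: dvd_imp_le)
qed

text \<open>Pairwise meeting red edges fit into two consecutive edges of the cycle. The other
  \<open>N - 2\<close> edges form a blue path on \<open>N - 1 = n * m\<close> vertices, which is cut
  into \<open>n\<close> paths of \<open>m\<close> vertices.\<close>

lemma cycle_arrow:
  assumes "m \<ge> 3" "n \<ge> 1"
  shows "\<exists>G :: nat graph. simple_graph G \<and> card (edges G) = n * m + 1 \<and>
    arrows G (copies 2 (complete_graph 2)) (copies n (path_graph m))"
proof -
  define N where "N = n * m + 1"
  \<comment> \<open>Excludes the triangle, whose three edges pairwise meet.\<close>
  have N: "N \<ge> 4"
    using assms mult_le_mono[of 1 n 3 m] by (simp add: N_def)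
  define ed where "ed t = {t mod N, Suc t mod N}" for t
  define G :: "nat graph" where "G = ({..<N}, ed ` {..<N})"
  have simple: "simple_graph G"
    unfolding simple_graph_def
  proof (intro conjI ballI)
    fix e assume "e \<in> edges G"
    then obtain t where "e = ed t"
      by (auto simp: G_def)
    moreover have "t mod N \<noteq> Suc t mod N"
      using N by (intro mod_neq_if_close) auto
    ultimately show "e \<subseteq> verts G" "card e = 2"
      using N by (auto simp: ed_def G_def)
  qed (simp add: G_def)
  \<comment> \<open>The starting points are at least two apart in both directions around the
    cycle.\<close>
  have ed_disj: "ed s \<inter> ed (s + d) = {}" if "2 \<le> d" "d + 2 \<le> N" for s d
    using that mod_neq_if_close[of s "s + d" N] mod_neq_if_close[of "Suc s" "s + d" N]
      mod_neq_if_close[of s "Suc (s + d)" N] mod_neq_if_close[of "Suc s" "Suc (s + d)" N]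
    by (auto simp: ed_def)
  have ed_neq: "ed s \<noteq> ed t" if "s < t" "t < N" for s t
  proof
    assume eq: "ed s = ed t"
    have "s mod N \<noteq> t mod N" "Suc s mod N \<noteq> Suc t mod N"
      using that mod_neq_if_close[of s t N] mod_neq_if_close[of "Suc s" "Suc t" N] by auto
    with eq have "s mod N = Suc t mod N" "Suc s mod N = t mod N"
      by (auto simp: ed_def doubleton_eq_iff)
    \<comment> \<open>Equality with swapped ends would put \<open>t\<close> at least
      \<open>N - 1\<close> and at most 1 beyond \<open>s\<close>.\<close>
    then have "\<not> Suc t < s + N" "\<not> Suc s < t"
      using that mod_neq_if_close[of s "Suc t" N] mod_neq_if_close[of "Suc s" t N] by auto
    then show False
      using that N by linarith
  qed
  then have "inj_on ed {..<N}"
    by (metis inj_onI lessThan_iff nat_neq_iff)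
  then have card: "card (edges G) = n * m + 1"
    by (simp add: G_def card_image N_def)
  have edge: "ed t \<in> edges G" for t
  proof -
    have "ed t = ed (t mod N)"
      by (simp add: ed_def mod_Suc_eq)
    then show ?thesis
      using N by (auto simp: G_def)
  qed
  have "arrows G (copies 2 (complete_graph 2)) (copies n (path_graph m))"
  proof (rule arrowsI[OF simple])
    show "m \<ge> 2"
      using assms by simp
    fix c :: "nat set \<Rightarrow> colour"
    assume red: "\<And>e e'. e \<in> edges G \<Longrightarrow> e' \<in> edges G \<Longrightarrow> c e = Red \<Longrightarrow> c e' = Red \<Longrightarrow> e \<inter> e' \<noteq> {}"
    have far: "c (ed (s + d)) = Blue" if "c (ed s) = Red" "2 \<le> d" "d + 2 \<le> N" for s d
      using red[OF edge edge that(1)] ed_disj[OF that(2,3)] not_Red_iff by blast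
    have "\<exists>s. \<forall>t. t + 2 < N \<longrightarrow> c (ed (s + t)) = Blue"
    proof (cases "\<exists>r. c (ed r) = Red")
      case True
      then obtain r where r: "c (ed r) = Red"
        by blast
      show ?thesis
      proof (cases "c (ed (Suc r)) = Red")
        case True
        have "c (ed (r + 2 + t)) = Blue" if "t + 2 < N" for t
        \<comment> \<open>The last edge, number \<open>r + N - 1\<close>, touches edge
          \<open>r\<close> around the cycle, but it is \<open>N - 2\<close> steps from the red edge
          \<open>Suc r\<close>.\<close>
        proof (cases "t + 3 = N")
          case True
          then show ?thesis
            using far[OF \<open>c (ed (Suc r)) = Red\<close>, of "t + 1"] N by simp
        next
          case False
          then show ?thesis
            using far[OF r, of "t + 2"] that by (simp add: add.commute add.left_commute)
        qed
        then show ?thesis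
          by blast
      next
        case False
        \<comment> \<open>The edge before \<open>r\<close> may be red as well; this range stops just
          short of it.\<close>
        have "c (ed (Suc r + t)) = Blue" if "t + 2 < N" for t
        proof (cases "t = 0")
          case True
          then show ?thesis
            using False by (simp add: not_Red_iff)
        next
          case False
          then show ?thesis
            using far[OF r, of "t + 1"] that by simp
        qed
        then show ?thesis
          by blast
      qed
    next
      case False
      then show ?thesis
        by (simp add: not_Red_iff)
    qed
    then obtain s where s: "\<And>t. t + 2 < N \<Longrightarrow> c (ed (s + t)) = Blue"
      by blast
    \<comment> \<open>Consecutive stretches of \<open>m\<close> vertices on the blue path that
      starts at \<open>s\<close>.\<close>
    let ?p = "\<lambda>(i, j). (s + (i * m + j)) mod N"
    have bound: "i * m + j < n * m" if "i < n" "j < m" for i j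
    proof -
      have "i * m + j < (i + 1) * m"
        using that by simp
      also have "\<dots> \<le> n * m"
        using that by (intro mult_le_mono) auto
      finally show ?thesis .
    qed
    have inj: "inj_on ?p ({..<n} \<times> {..<m})"
    proof (rule inj_onI)
      fix x y assume "x \<in> {..<n} \<times> {..<m}" "y \<in> {..<n} \<times> {..<m}" "?p x = ?p y"
      moreover obtain i j i' j' where xy: "x = (i, j)" "y = (i', j')"
        by (cases x, cases y)
      ultimately have *: "i < n" "i' < n" "j < m" "j' < m"
          "(s + (i * m + j)) mod N = (s + (i' * m + j')) mod N"
        by auto
      have "i * m + j < N" "i' * m + j' < N"
        using bound[of i j] bound[of i' j'] * by (auto simp: N_def)
      then have "i * m + j = i' * m + j'"
        using *(5) mod_neq_if_close[of "s + (i * m + j)" "s + (i' * m + j')" N]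
          mod_neq_if_close[of "s + (i' * m + j')" "s + (i * m + j)" N]
        by (cases "i * m + j" "i' * m + j'" rule: linorder_cases) auto
      then show "x = y"
        using * xy mult_add_eq_iff by simp
    qed
    have "{?p (i, j), ?p (i, Suc j)} \<in> edges G \<and> c {?p (i, j), ?p (i, Suc j)} = Blue"
      if "i < n" "Suc j < m" for i j
    proof -
      have "{?p (i, j), ?p (i, Suc j)} = ed (s + (i * m + j))"
        by (simp add: ed_def)
      moreover have "(i * m + j) + 2 < N"
        using bound[of i "Suc j"] that by (simp add: N_def)
      ultimately show ?thesis
        using s edge by metis
    qed
    with inj show "\<exists>p. inj_on p ({..<n} \<times> {..<m}) \<and>
        (\<forall>i<n. \<forall>j. Suc j < m \<longrightarrow>
          {p (i, j), p (i, Suc j)} \<in> edges G \<and> c {p (i, j), p (i, Suc j)} = Blue)"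
      by blast
  qed
  with simple card show ?thesis
    by blast
qed

theorem theorem6:
  fixes n m :: nat
  assumes "n \<ge> 1" and "m \<ge> 2"
  shows "size_ramsey (copies 2 (complete_graph 2)) (copies n (path_graph m)) =
           min (n * m + 1) ((n + 1) * (m - 1))"
  unfolding size_ramsey_def
proof (rule Least_equality)
  have "\<exists>G :: nat graph. simple_graph G \<and> card (edges G) = min (n * m + 1) ((n + 1) * (m - 1)) \<and>
      arrows G (copies 2 (complete_graph 2)) (copies n (path_graph m))"
  proof (cases "(n + 1) * (m - 1) \<le> n * m + 1")
    case True
    then show ?thesis
      using disjoint_paths_arrow[OF assms(2), of n] by (simp add: min_absorb2)
  next
    case False
    \<comment> \<open>For \<open>m = 2\<close> the second term \<open>n + 1\<close> is the smaller
      one, so the cycle is needed only for \<open>m \<ge> 3\<close>.\<close>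
    then have "m \<noteq> 2"
      by auto
    then show ?thesis
      using cycle_arrow[of m n] assms False by (simp add: min_absorb1)
  qed
  then show "0 < min (n * m + 1) ((n + 1) * (m - 1)) \<and>
      (\<exists>G :: nat graph. simple_graph G \<and> card (edges G) = min (n * m + 1) ((n + 1) * (m - 1)) \<and>
        arrows G (copies 2 (complete_graph 2)) (copies n (path_graph m)))"
    using assms by simp
qed (use arrows_edges_ge[OF _ assms] in blast)

end
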